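(* Let $0\leqslant\beta<1$ and let $(x_n)_{n\in\mathbb N}\subseteq[0,1]$. Assume there exists a constant $s_0>0$ such that $\lim_{N\to\infty}R_2(\beta;s,N)=2s$ for all $0<s<s_0$. Then $(x_n)_{n\in\mathbb N}$ has $\beta$--PPC.
   Context: For $x\in\mathbb R$, $\|x\|$ is the distance from $x$ to the nearest integer. For $0\leqslant\beta\leqslant1$, $s>0$, $N\geqslant1$: $R_2(\beta;s,N)=\frac{1}{N^{2-\beta}}\#\{(m,n):1\leqslant m,n\leqslant N,\ m\neq n,\ \|x_m-x_n\|\leqslant s/N^{\beta}\}$. For $0<\beta\leqslant1$, the sequence has $\beta$--PPC (weak Poissonian pair correlations with parameter $\beta$) if $\lim_{N\to\infty}R_2(\beta;s,N)=2s$ for all $s>0$; for $\beta=0$, it has $0$--PPC if $\lim_{N\to\infty}R_2(0;s,N)=2s$ for all $0<s\leqslant\frac12$. *)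

theory Defs
  imports Complex_Main
begin

definition dist_nearest_int :: "real \<Rightarrow> real" where
  "dist_nearest_int x = \<bar>x - of_int (round x)\<bar>"

text \<open>Sequences are indexed from 1; the value \<open>x 0\<close> is never used.\<close>

definition pair_corr :: "(nat \<Rightarrow> real) \<Rightarrow> real \<Rightarrow> real \<Rightarrow> nat \<Rightarrow> real" where
  "pair_corr x \<beta> s N =
     1 / real N powr (2 - \<beta>) *
     real (card {(m, n). m \<in> {1..N} \<and> n \<in> {1..N} \<and> m \<noteq> n \<and>
                         dist_nearest_int (x m - x n) \<le> s / real N powr \<beta>})"

definition has_PPC :: "real \<Rightarrow> (nat \<Rightarrow> real) \<Rightarrow> bool" where
  "has_PPC \<beta> x \<longleftrightarrow>
     (0 < \<beta> \<and> \<beta> \<le> 1 \<and> (\<forall>s>0. (\<lambda>N. pair_corr x \<beta> s N) \<longlonglongrightarrow> 2 * s)) \<or>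
     (\<beta> = 0 \<and> (\<forall>s. 0 < s \<and> s \<le> 1 / 2 \<longrightarrow> (\<lambda>N. pair_corr x 0 s N) \<longlonglongrightarrow> 2 * s))"

end

theory Submission
  imports Defs "HOL-Real_Asymp.Real_Asymp"
begin

text \<open>
  Split the circle into \<open>M \<approx> k N\<^sup>\<beta>\<close> equal cells, with \<open>k\<close> a large constant, and count the points in
  windows of \<open>H\<close> consecutive cells. As \<open>\<beta> < 1\<close>, the diagonal pairs are negligible, so the second moment
  of the window counts is governed by the pair correlations at the scales \<open>h / k\<close> with \<open>h \<le> H\<close>.
  If \<open>H / k < s\<^sub>0\<close>, the hypothesis makes it asymptotically at most \<open>1 + O(1 / H)\<close> times the squared
  mean: the variance is small, so the window counts are nearly constant and windows at any
  distance \<open>u\<close> are nearly uncorrelated. Summing these correlations over \<open>\<bar>u\<bar> \<le> D\<close> counts, up to an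
  error of \<open>H\<close> cells in the distance, the pairs at distance at most \<open>D / M\<close>, now with \<open>D / k\<close>
  arbitrary. Letting first \<open>k\<close> and then \<open>H\<close> tend to infinity gives the limit \<open>2 s\<close> at every scale.
\<close>

section \<open>Point counts in cells of the circle and their cyclic correlations\<close>

text \<open>With \<open>y m\<close> the floor of M times the m-th point, this counts the points in
  cell j. Testing divisibility instead of equality closes the M cells to a circle, so j may be any
  integer.\<close>

definition cell_count :: "nat set \<Rightarrow> (nat \<Rightarrow> int) \<Rightarrow> int \<Rightarrow> int \<Rightarrow> real" where
  "cell_count I y M j = (\<Sum>m\<in>I. of_bool (M dvd y m - j))"

text \<open>The cyclic autocorrelation of the cell counts, see \<open>sum_cell_count_mult\<close>.
  The diagonal pairs m = n are included.\<close>

definition diff_count :: "nat set \<Rightarrow> (nat \<Rightarrow> int) \<Rightarrow> int \<Rightarrow> int \<Rightarrow> real" where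
  "diff_count I y M d = (\<Sum>m\<in>I. \<Sum>n\<in>I. of_bool (M dvd y m - y n - d))"

definition window_count :: "nat set \<Rightarrow> (nat \<Rightarrow> int) \<Rightarrow> int \<Rightarrow> nat \<Rightarrow> int \<Rightarrow> real" where
  "window_count I y M H j = (\<Sum>i<H. cell_count I y M (j + int i))"

text \<open>The cyclic autocorrelation of \<open>window_count\<close> at lag u, as
  \<open>sum_window_count_mult\<close> shows. It is written through \<open>diff_count\<close> to be
  comparable with pair counts.\<close>

definition window_corr :: "nat set \<Rightarrow> (nat \<Rightarrow> int) \<Rightarrow> int \<Rightarrow> nat \<Rightarrow> int \<Rightarrow> real" where
  "window_corr I y M H u = (\<Sum>i<H. \<Sum>i'<H. diff_count I y M (int i - int i' - u))"

definition close_pairs :: "(nat \<Rightarrow> real) \<Rightarrow> nat \<Rightarrow> real \<Rightarrow> real" where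
  "close_pairs x N r =
     (\<Sum>m\<in>{1..N}. \<Sum>n\<in>{1..N}. of_bool (dist_nearest_int (x m - x n) \<le> r))"

lemma sum_of_bool_dvd_diff:
  fixes M a :: int and f :: "int \<Rightarrow> real"
  assumes "M > 0"
  shows "(\<Sum>j\<in>{0..<M}. of_bool (M dvd a - j) * f j) = f (a mod M)"
proof -
  have "M dvd a - j \<longleftrightarrow> j = a mod M" if "j \<in> {0..<M}" for j
    using that by (auto simp flip: mod_eq_dvd_iff)
  then have "(\<Sum>j\<in>{0..<M}. of_bool (M dvd a - j) * f j) =
             (\<Sum>j\<in>{0..<M}. if j = a mod M then f j else 0)"
    by (intro sum.cong) auto
  also have "\<dots> = f (a mod M)"
    using assms by simp
  finally show ?thesis .
qed

lemma sum_cell_count: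
  assumes "M > 0"
  shows "(\<Sum>j\<in>{0..<M}. cell_count I y M (j + a)) = real (card I)"
proof -
  have "(\<Sum>j\<in>{0..<M}. cell_count I y M (j + a)) =
        (\<Sum>m\<in>I. \<Sum>j\<in>{0..<M}. of_bool (M dvd (y m - a) - j) * 1)"
    unfolding cell_count_def by (subst sum.swap) (simp add: algebra_simps)
  then show ?thesis
    by (simp only: sum_of_bool_dvd_diff[OF assms]) simp
qed

lemma sum_cell_count_mult:
  assumes "M > 0"
  shows "(\<Sum>j\<in>{0..<M}. cell_count I y M (j + a) * cell_count I y M (j + b))
         = diff_count I y M (a - b)"
proof -
  \<comment> \<open>The first indicator forces j to be the residue of \<open>y m - a\<close>. For
    that j the second one depends only on the difference \<open>y m - y n\<close>.\<close>
  have *: "M dvd y n - ((y m - a) mod M + b) \<longleftrightarrow> M dvd y m - y n - (a - b)" for m n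
  proof -
    have "y n - ((y m - a) mod M + b) = - (y m - y n - (a - b)) + M * ((y m - a) div M)"
      using mult_div_mod_eq[of M "y m - a"] by (simp add: algebra_simps)
    then show ?thesis
      by (metis dvd_add_times_triv_right_iff dvd_minus_iff mult.commute)
  qed
  have "(\<Sum>j\<in>{0..<M}. cell_count I y M (j + a) * cell_count I y M (j + b)) =
        (\<Sum>j\<in>{0..<M}. \<Sum>m\<in>I. \<Sum>n\<in>I.
           of_bool (M dvd (y m - a) - j) * of_bool (M dvd y n - (j + b)))"
    unfolding cell_count_def sum_product by (intro sum.cong refl) (simp add: algebra_simps)
  also have "\<dots> = (\<Sum>m\<in>I. \<Sum>n\<in>I. \<Sum>j\<in>{0..<M}.
           of_bool (M dvd (y m - a) - j) * of_bool (M dvd y n - (j + b)))"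
    by (subst sum.swap, rule sum.cong[OF refl], subst sum.swap, rule refl)
  also have "\<dots> = diff_count I y M (a - b)"
    by (simp only: sum_of_bool_dvd_diff[OF assms] * diff_count_def)
  finally show ?thesis .
qed

lemma sum_window_count:
  assumes "M > 0"
  shows "(\<Sum>j\<in>{0..<M}. window_count I y M H (j + a)) = real H * real (card I)"
proof -
  have "(\<Sum>j\<in>{0..<M}. window_count I y M H (j + a)) =
        (\<Sum>i<H. \<Sum>j\<in>{0..<M}. cell_count I y M (j + (a + int i)))"
    unfolding window_count_def by (subst sum.swap) (simp add: add.assoc)
  then show ?thesis
    by (simp only: sum_cell_count[OF assms]) simp
qed

lemma sum_window_count_mult:
  assumes "M > 0"
  shows "(\<Sum>j\<in>{0..<M}. window_count I y M H (j + a) * window_count I y M H (j + b))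
         = window_corr I y M H (b - a)"
proof -
  have "(\<Sum>j\<in>{0..<M}. window_count I y M H (j + a) * window_count I y M H (j + b)) =
        (\<Sum>j\<in>{0..<M}. \<Sum>i<H. \<Sum>i'<H.
           cell_count I y M (j + (a + int i)) * cell_count I y M (j + (b + int i')))"
    unfolding window_count_def sum_product by (simp add: add.assoc)
  also have "\<dots> = (\<Sum>i<H. \<Sum>i'<H. \<Sum>j\<in>{0..<M}.
           cell_count I y M (j + (a + int i)) * cell_count I y M (j + (b + int i')))"
    by (subst sum.swap, rule sum.cong[OF refl], subst sum.swap, rule refl)
  also have "\<dots> = window_corr I y M H (b - a)"
    unfolding window_corr_def sum_cell_count_mult[OF assms]
    by (intro sum.cong refl arg_cong[where f = "diff_count I y M"]) simp
  finally show ?thesis .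
qed

text \<open>The window counts have mean \<open>H \<cdot> card I / M\<close>; by \<open>2 \<bar>a b\<bar> \<le> a\<^sup>2 + b\<^sup>2\<close> their covariance
  at any lag is at most their variance.\<close>

lemma window_corr_deviation:
  fixes I :: "nat set" and H :: nat
  assumes "M > 0"
  defines "A \<equiv> (real H * real (card I))\<^sup>2 / of_int M"
  shows "\<bar>window_corr I y M H u - A\<bar> \<le> window_corr I y M H 0 - A"
proof -
  define g where "g = window_count I y M H"
  define \<mu> where "\<mu> = real H * real (card I) / of_int M"
  have cov: "(\<Sum>j\<in>{0..<M}. (g (j + a) - \<mu>) * (g (j + b) - \<mu>)) = window_corr I y M H (b - a) - A"
    for a b
  proof -
    have "(\<Sum>j\<in>{0..<M}. (g (j + a) - \<mu>) * (g (j + b) - \<mu>)) =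
          (\<Sum>j\<in>{0..<M}. g (j + a) * g (j + b)) - \<mu> * (\<Sum>j\<in>{0..<M}. g (j + a))
          - \<mu> * (\<Sum>j\<in>{0..<M}. g (j + b)) + of_int M * \<mu>\<^sup>2"
      using assms(1)
      by (simp add: algebra_simps sum.distrib sum_subtractf sum_distrib_left power2_eq_square)
    also have "\<dots> = window_corr I y M H (b - a) - A"
      using assms(1)
      unfolding g_def sum_window_count_mult[OF assms(1)] sum_window_count[OF assms(1)] A_def \<mu>_def
      by (simp add: field_simps power2_eq_square)
    finally show ?thesis .
  qed
  have "\<bar>window_corr I y M H u - A\<bar> = \<bar>\<Sum>j\<in>{0..<M}. (g (j + 0) - \<mu>) * (g (j + u) - \<mu>)\<bar>"
    unfolding cov by simp
  also have "\<dots> \<le> (\<Sum>j\<in>{0..<M}. \<bar>(g (j + 0) - \<mu>) * (g (j + u) - \<mu>)\<bar>)"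
    by (rule sum_abs)
  also have "\<dots> \<le> (\<Sum>j\<in>{0..<M}. ((g (j + 0) - \<mu>) * (g (j + 0) - \<mu>) + (g (j + u) - \<mu>) * (g (j + u) - \<mu>)) / 2)"
  proof (rule sum_mono)
    fix j
    have "\<bar>p * q\<bar> \<le> (p * p + q * q) / 2" for p q :: real
      using sum_squares_bound[of "\<bar>p\<bar>" "\<bar>q\<bar>"] by (simp add: abs_mult power2_eq_square)
    then show "\<bar>(g (j + 0) - \<mu>) * (g (j + u) - \<mu>)\<bar>
      \<le> ((g (j + 0) - \<mu>) * (g (j + 0) - \<mu>) + (g (j + u) - \<mu>) * (g (j + u) - \<mu>)) / 2" .
  qed
  \<comment> \<open>Both sums of squares are instances of \<open>cov\<close> with a = b, which
    depends on b - a only.\<close>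
  also have "\<dots> = window_corr I y M H 0 - A"
    unfolding sum_divide_distrib[symmetric] sum.distrib cov by simp
  finally show ?thesis .
qed

section \<open>Window correlations as sums of difference counts\<close>

text \<open>Enlarging the square from H to H + 1 adds a row, a column and a corner, whose
  differences fill {-H..H} exactly once. At lag 0 this turns a window correlation into pair counts
  over symmetric ranges.\<close>

lemma sum_differences_eq:
  fixes f :: "int \<Rightarrow> real"
  shows "(\<Sum>i<H. \<Sum>i'<H. f (int i - int i')) = (\<Sum>h<H. \<Sum>d\<in>{- int h..int h}. f d)"
proof (induction H)
  case (Suc H)
  have a: "(\<Sum>i<n. f (int n - int i)) = (\<Sum>d\<in>{1..int n}. f d)" for n
    by (rule sum.reindex_bij_witness[of _ "\<lambda>d. n - nat d" "\<lambda>i. int n - int i"]) auto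
  have b: "(\<Sum>i<n. f (int i - int n)) = (\<Sum>d\<in>{- int n..-1}. f d)" for n
    by (rule sum.reindex_bij_witness[of _ "\<lambda>d. nat (d + n)" "\<lambda>i. int i - int n"]) auto
  have "{- int H..int H} = {- int H..-1} \<union> ({0} \<union> {1..int H})"
    by auto
  then have c: "(\<Sum>d\<in>{- int H..int H}. f d) = (\<Sum>d\<in>{- int H..-1}. f d) + (f 0 + (\<Sum>d\<in>{1..int H}. f d))"
    by (simp only:) (subst sum.union_disjoint; auto)+
  show ?case
    using Suc.IH a[of H] b[of H] c by (simp add: sum.distrib)
qed auto

lemma diff_count_nonneg: "diff_count I y M d \<ge> 0"
  unfolding diff_count_def by (intro sum_nonneg) auto

lemma sum_window_corr:
  "(\<Sum>u\<in>{- int D..int D}. window_corr I y M H u) =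
   (\<Sum>i<H. \<Sum>i'<H. \<Sum>d\<in>{int i - int i' - int D..int i - int i' + int D}. diff_count I y M d)"
proof -
  have "(\<Sum>u\<in>{- int D..int D}. window_corr I y M H u) =
    (\<Sum>i<H. \<Sum>i'<H. \<Sum>u\<in>{- int D..int D}. diff_count I y M (int i - int i' - u))"
    unfolding window_corr_def
    by (subst sum.swap, rule sum.cong[OF refl], subst sum.swap, rule refl)
  moreover have "(\<Sum>u\<in>{- int D..int D}. diff_count I y M (int i - int i' - u)) =
     (\<Sum>d\<in>{int i - int i' - int D..int i - int i' + int D}. diff_count I y M d)" for i i'
    by (rule sum.reindex_bij_witness[of _ "\<lambda>d. int i - int i' - d" "\<lambda>d. int i - int i' - d"]) auto
  ultimately show ?thesis by simp
qed

text \<open>As i - i' is less than H in absolute value, every shifted range in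
  \<open>sum_window_corr\<close> with radius h + H still covers {-h..h}. Conversely, a shifted range
  of radius D stays within radius D + H, which gives the next lemma.\<close>

lemma sum_diff_count_le_window_corr:
  "(real H)\<^sup>2 * (\<Sum>d\<in>{- int h..int h}. diff_count I y M d)
   \<le> (\<Sum>u\<in>{- int (h + H)..int (h + H)}. window_corr I y M H u)"
proof -
  have "(real H)\<^sup>2 * (\<Sum>d\<in>{- int h..int h}. diff_count I y M d) =
        (\<Sum>i<H. \<Sum>i'<H. \<Sum>d\<in>{- int h..int h}. diff_count I y M d)"
    by (simp add: power2_eq_square)
  also have "\<dots> \<le> (\<Sum>u\<in>{- int (h + H)..int (h + H)}. window_corr I y M H u)"
    unfolding sum_window_corr
    by (intro sum_mono sum_mono2 diff_count_nonneg) auto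
  finally show ?thesis .
qed

lemma window_corr_le_sum_diff_count:
  "(\<Sum>u\<in>{- int D..int D}. window_corr I y M H u)
   \<le> (real H)\<^sup>2 * (\<Sum>d\<in>{- int (D + H)..int (D + H)}. diff_count I y M d)"
proof -
  have "(\<Sum>u\<in>{- int D..int D}. window_corr I y M H u)
      \<le> (\<Sum>i<H. \<Sum>i'<H. \<Sum>d\<in>{- int (D + H)..int (D + H)}. diff_count I y M d)"
    unfolding sum_window_corr
    by (intro sum_mono sum_mono2 diff_count_nonneg) auto
  also have "\<dots> = (real H)\<^sup>2 * (\<Sum>d\<in>{- int (D + H)..int (D + H)}. diff_count I y M d)"
    by (simp add: power2_eq_square)
  finally show ?thesis .
qed

section \<open>From difference counts to close pairs\<close>

lemma sum_diff_count:
  "(\<Sum>d\<in>{- int h..int h}. diff_count I y M d) =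
   (\<Sum>m\<in>I. \<Sum>n\<in>I. real (card {d \<in> {- int h..int h}. M dvd y m - y n - d}))"
proof -
  have "(\<Sum>d\<in>{- int h..int h}. diff_count I y M d) =
        (\<Sum>m\<in>I. \<Sum>n\<in>I. \<Sum>d\<in>{- int h..int h}. of_bool (M dvd y m - y n - d))"
    unfolding diff_count_def
    by (subst sum.swap, rule sum.cong[OF refl], subst sum.swap, rule refl)
  then show ?thesis
    by (simp add: Int_def)
qed

lemma close_pairs_le_sum_diff_count:
  assumes "M > 0" "r \<le> real h / of_int M"
  shows "close_pairs x N r \<le>
         (\<Sum>d\<in>{- int h..int h}. diff_count {1..N} (\<lambda>n. \<lfloor>of_int M * x n\<rfloor>) M d)"
  unfolding close_pairs_def sum_diff_count
proof (intro sum_mono)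
  fix m n
  let ?y = "\<lambda>n. \<lfloor>of_int M * x n\<rfloor>"
  let ?S = "{d \<in> {- int h..int h}. M dvd ?y m - ?y n - d}"
  show "of_bool (dist_nearest_int (x m - x n) \<le> r) \<le> real (card ?S)"
  proof (cases "dist_nearest_int (x m - x n) \<le> r")
    case True
    define z where "z = round (x m - x n)"
    have "of_int M * \<bar>x m - x n - of_int z\<bar> \<le> of_int M * (real h / of_int M)"
      using True assms by (intro mult_left_mono) (auto simp: dist_nearest_int_def z_def)
    then have "\<bar>of_int M * (x m - x n - of_int z)\<bar> \<le> real h"
      using assms(1) by (simp add: abs_mult)
    then have "\<bar>of_int M * x m - of_int M * x n - of_int (M * z)\<bar> \<le> real h"
      by (simp add: algebra_simps)
    \<comment> \<open>Rounding costs nothing here: a bound by an integer h survives taking floors,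
      since the floors change the difference by less than 1 and the result is an integer.\<close>
    then have "\<bar>?y m - ?y n - M * z\<bar> \<le> int h"
      by linarith
    then have "?y m - ?y n - M * z \<in> ?S"
      by auto
    moreover have "finite ?S" by (rule finite_subset[of _ "{- int h..int h}"]) auto
    ultimately have "card ?S \<ge> 1"
      by (metis One_nat_def Suc_leI card_gt_0_iff empty_iff)
    then show ?thesis by simp
  qed simp
qed

text \<open>In this direction undoing the floors costs up to 1, hence h + 1. The bound on 2h + 1
  makes the values in {-h..h} distinct modulo M, so that no pair is counted twice.\<close>

lemma sum_diff_count_le_close_pairs:
  assumes "2 * int h + 1 \<le> M" "real (h + 1) / of_int M \<le> r"
  shows "(\<Sum>d\<in>{- int h..int h}. diff_count {1..N} (\<lambda>n. \<lfloor>of_int M * x n\<rfloor>) M d)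
         \<le> close_pairs x N r"
  unfolding close_pairs_def sum_diff_count
proof (intro sum_mono)
  fix m n
  let ?y = "\<lambda>n. \<lfloor>of_int M * x n\<rfloor>"
  let ?S = "{d \<in> {- int h..int h}. M dvd ?y m - ?y n - d}"
  have M: "M > 0" using assms(1) by linarith
  show "real (card ?S) \<le> of_bool (dist_nearest_int (x m - x n) \<le> r)"
  proof (cases "?S = {}")
    case False
    then obtain d where d: "d \<in> ?S" by blast
    then obtain z where z: "?y m - ?y n - d = M * z" by (auto simp: dvd_def)
    have "e = d" if "e \<in> ?S" for e
    proof -
      have "M dvd (?y m - ?y n - d) - (?y m - ?y n - e)"
        using d that by (metis (no_types, lifting) dvd_diff mem_Collect_eq)
      then have "M dvd e - d" by simp
      moreover have "\<bar>e - d\<bar> < M" using d that assms(1) by auto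
      ultimately show ?thesis
        using zdvd_not_zless[of "\<bar>e - d\<bar>" M] by (cases "e = d") auto
    qed
    with d have "?S = {d}" by blast
    then have card: "card ?S = 1" by (simp only: card.insert) simp
    have "\<bar>?y m - ?y n - M * z\<bar> \<le> int h" using d z by auto
    then have "\<bar>of_int M * x m - of_int M * x n - of_int (M * z)\<bar> \<le> real (h + 1)"
      by linarith
    then have "\<bar>of_int M * (x m - x n - of_int z)\<bar> \<le> real (h + 1)"
      by (simp add: algebra_simps)
    then have "\<bar>x m - x n - of_int z\<bar> \<le> real (h + 1) / of_int M"
      using M by (simp add: abs_mult pos_le_divide_eq mult.commute)
    moreover have "dist_nearest_int (x m - x n) \<le> \<bar>x m - x n - of_int z\<bar>"
      unfolding dist_nearest_int_def by (rule round_diff_minimal)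
    ultimately show ?thesis using card assms(2) by simp
  next
    case True
    then show ?thesis by (simp only: card.empty) simp
  qed
qed

text \<open>The additional term is the N diagonal pairs after normalisation. It tends to 0 exactly
  because \<beta> < 1.\<close>

lemma close_pairs_eq_pair_corr:
  assumes "s \<ge> 0" "N \<ge> 1"
  shows "close_pairs x N (s / real N powr \<beta>) / real N powr (2 - \<beta>) =
         pair_corr x \<beta> s N + real N powr (\<beta> - 1)"
proof -
  define r where "r = s / real N powr \<beta>"
  define S where "S = {(m, n). m \<in> {1..N} \<and> n \<in> {1..N} \<and> m \<noteq> n \<and> dist_nearest_int (x m - x n) \<le> r}"
  have "r \<ge> 0" unfolding r_def using assms by simp
  have "close_pairs x N r = (\<Sum>p\<in>{1..N} \<times> {1..N}. of_bool (dist_nearest_int (x (fst p) - x (snd p)) \<le> r))"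
    unfolding close_pairs_def sum.cartesian_product case_prod_unfold ..
  also have "\<dots> = real (card {p \<in> {1..N} \<times> {1..N}. dist_nearest_int (x (fst p) - x (snd p)) \<le> r})"
    by (simp add: Int_def)
  also have "{p \<in> {1..N} \<times> {1..N}. dist_nearest_int (x (fst p) - x (snd p)) \<le> r} =
             S \<union> (\<lambda>n. (n, n)) ` {1..N}"
    using \<open>r \<ge> 0\<close> by (auto simp: S_def dist_nearest_int_def)
  also have "card \<dots> = card S + card ((\<lambda>n. (n, n)) ` {1..N})"
    by (intro card_Un_disjoint finite_subset[of S "{1..N} \<times> {1..N}"]) (auto simp: S_def)
  also have "card ((\<lambda>n. (n, n)) ` {1..N}) = N"
    by (subst card_image) (auto simp: inj_on_def)
  finally have "close_pairs x N r = real (card S) + real N" by simp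
  moreover have "real N / real N powr (2 - \<beta>) = real N powr (\<beta> - 1)"
    using assms powr_diff[of "real N" 1 "2 - \<beta>"] by simp
  ultimately show ?thesis
    unfolding pair_corr_def r_def S_def by (simp add: add_divide_distrib)
qed


lemma close_pairs_tendsto:
  assumes "\<beta> < 1" "s > 0" "(\<lambda>N. pair_corr x \<beta> s N) \<longlonglongrightarrow> 2 * s"
  shows "(\<lambda>N. close_pairs x N (s / real N powr \<beta>) / real N powr (2 - \<beta>)) \<longlonglongrightarrow> 2 * s"
proof -
  have "(\<lambda>N. real N powr (\<beta> - 1)) \<longlonglongrightarrow> 0"
    using assms(1) by (intro tendsto_neg_powr filterlim_real_sequentially) auto
  then have "(\<lambda>N. pair_corr x \<beta> s N + real N powr (\<beta> - 1)) \<longlonglongrightarrow> 2 * s + 0"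
    by (intro tendsto_add assms(3))
  moreover have "\<forall>\<^sub>F N in sequentially. pair_corr x \<beta> s N + real N powr (\<beta> - 1) =
      close_pairs x N (s / real N powr \<beta>) / real N powr (2 - \<beta>)"
    using eventually_ge_at_top[of 1]
    by eventually_elim (use assms(2) in \<open>simp add: close_pairs_eq_pair_corr\<close>)
  ultimately show ?thesis
    by (simp add: tendsto_cong)
qed

section \<open>Asymptotic size of the mean and variance of the window counts\<close>

lemma window_mean_bounds:
  fixes N k H :: nat and \<beta> :: real
  assumes "0 \<le> \<beta>" "N \<ge> 1" "k \<ge> 1"
  defines "M \<equiv> \<lceil>real k * real N powr \<beta>\<rceil>" and "T \<equiv> real N powr (2 - \<beta>)"
  shows "real k * real N powr \<beta> \<le> of_int M" "of_int M \<le> (real k + 1) * real N powr \<beta>"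
    "(real H * real N)\<^sup>2 / of_int M \<le> (real H)\<^sup>2 / real k * T"
    "(real H)\<^sup>2 / (real k + 1) * T \<le> (real H * real N)\<^sup>2 / of_int M"
proof -
  define L where "L = real N powr \<beta>"
  have L: "L \<ge> 1" unfolding L_def using assms by (simp add: ge_one_powr_ge_zero)
  show lo: "real k * real N powr \<beta> \<le> of_int M" unfolding M_def by linarith
  \<comment> \<open>The ceiling adds less than 1, which is at most \<open>L\<close>.\<close>
  show hi: "of_int M \<le> (real k + 1) * real N powr \<beta>"
    unfolding M_def L_def[symmetric] using L by (simp add: algebra_simps) linarith
  have T: "T = (real N)\<^sup>2 / L"
    unfolding T_def L_def using assms by (simp add: powr_diff powr_numeral)
  have kL: "real k * L > 0" using L assms(3) by simp
  have "(real H * real N)\<^sup>2 / of_int M \<le> (real H * real N)\<^sup>2 / (real k * L)"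
    using lo kL by (intro divide_left_mono) (auto simp: L_def)
  then show "(real H * real N)\<^sup>2 / of_int M \<le> (real H)\<^sup>2 / real k * T"
    unfolding T by (simp add: power_mult_distrib)
  have "(real H * real N)\<^sup>2 / ((real k + 1) * L) \<le> (real H * real N)\<^sup>2 / of_int M"
    using lo hi kL L by (intro divide_left_mono) (auto simp: L_def)
  then show "(real H)\<^sup>2 / (real k + 1) * T \<le> (real H * real N)\<^sup>2 / of_int M"
    unfolding T by (simp add: power_mult_distrib)
qed

text \<open>The lag 0 correlation is at most a sum of close pair counts at the scales (h + 1) / k
  with h < H, all below \<open>s\<^sub>0\<close>; by hypothesis the normalised sum tends to H (H +
  1) / k. The squared mean term cancels the main part H^2 / k, so what remains is smaller by a
  factor of order 1 / H.\<close>

lemma eventually_window_variance_le: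
  fixes x :: "nat \<Rightarrow> real" and \<beta> s\<^sub>0 :: real and k H :: nat
  assumes \<beta>: "0 \<le> \<beta>" "\<beta> < 1"
    and lim: "\<And>s. 0 < s \<Longrightarrow> s < s\<^sub>0 \<Longrightarrow> (\<lambda>N. pair_corr x \<beta> s N) \<longlonglongrightarrow> 2 * s"
    and k: "k \<ge> 1" "2 * H \<le> k" "H\<^sup>2 \<le> k" "real H / real k < s\<^sub>0"
  defines "M \<equiv> \<lambda>N. \<lceil>real k * real N powr \<beta>\<rceil>"
  shows "\<forall>\<^sub>F N in sequentially.
     window_corr {1..N} (\<lambda>n. \<lfloor>of_int (M N) * x n\<rfloor>) (M N) H 0 - (real H * real N)\<^sup>2 / of_int (M N)
     \<le> (real H + 2) / real k * real N powr (2 - \<beta>)"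
proof -
  have M_app: "M N = \<lceil>real k * real N powr \<beta>\<rceil>" for N
    by (simp add: M_def)
  have "(\<lambda>N. \<Sum>h<H. close_pairs x N (real (h + 1) / real k / real N powr \<beta>) / real N powr (2 - \<beta>))
     \<longlonglongrightarrow> (\<Sum>h<H. 2 * (real (h + 1) / real k))"
  proof (intro tendsto_sum close_pairs_tendsto lim \<beta>)
    fix h assume "h \<in> {..<H}"
    then have "real (h + 1) / real k \<le> real H / real k"
      by (intro divide_right_mono) auto
    then show "real (h + 1) / real k < s\<^sub>0" using k(4) by linarith
  qed (use k(1) in auto)
  moreover have "(\<Sum>h<n. 2 * (real (h + 1) / real k)) = real n * (real n + 1) / real k" for n
    using k(1) by (induction n) (auto simp: field_simps)
  \<comment> \<open>The slack 1 / k passes from the limit to an eventual bound. A second 1 / k comes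
    from replacing H^2 / (k + 1) by H^2 / k, where H^2 \<le> k is used; together they make H +
    2.\<close>
  ultimately have "\<forall>\<^sub>F N in sequentially.
     (\<Sum>h<H. close_pairs x N (real (h + 1) / real k / real N powr \<beta>) / real N powr (2 - \<beta>))
     < real H * (real H + 1) / real k + 1 / real k"
    using k(1) by (intro order_tendstoD(2)) auto
  then show ?thesis
    using eventually_ge_at_top[of 1]
  proof eventually_elim
    case (elim N)
    define T where "T = real N powr (2 - \<beta>)"
    define y where "y = (\<lambda>n. \<lfloor>of_int (M N) * x n\<rfloor>)"
    note b = window_mean_bounds[OF \<beta>(1) elim(2) k(1), folded M_app]
    have T: "T > 0" unfolding T_def using elim by simp
    have L: "real N powr \<beta> \<ge> 1" using elim \<beta> by (simp add: ge_one_powr_ge_zero)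
    then have "real k \<le> real k * real N powr \<beta>" using k(1) by simp
    then have kM: "int k \<le> M N" using b(1) by linarith
    have "window_corr {1..N} y (M N) H 0 =
          (\<Sum>h<H. \<Sum>d\<in>{- int h..int h}. diff_count {1..N} y (M N) d)"
      unfolding window_corr_def using sum_differences_eq[of "diff_count {1..N} y (M N)" H] by simp
    also have "\<dots> \<le> (\<Sum>h<H. close_pairs x N (real (h + 1) / real k / real N powr \<beta>))"
      unfolding y_def
    proof (intro sum_mono sum_diff_count_le_close_pairs)
      fix h assume "h \<in> {..<H}"
      then show "2 * int h + 1 \<le> M N" using kM k(2) by auto
      have "real (h + 1) / of_int (M N) \<le> real (h + 1) / (real k * real N powr \<beta>)"
        using b(1) kM elim(2) k(1) by (intro divide_left_mono mult_pos_pos) auto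
      then show "real (h + 1) / of_int (M N) \<le> real (h + 1) / real k / real N powr \<beta>"
        by simp
    qed
    also have "\<dots> \<le> (real H * (real H + 1) / real k + 1 / real k) * T"
      using elim(1) T unfolding T_def sum_divide_distrib[symmetric] by (simp add: field_simps)
    finally have "window_corr {1..N} y (M N) H 0 - (real H * real N)\<^sup>2 / of_int (M N)
      \<le> (real H * (real H + 1) / real k + 1 / real k) * T - (real H)\<^sup>2 / (real k + 1) * T"
      using b(4)[of H] unfolding T_def by linarith
    also have "\<dots> = (real H * (real H + 1) / real k + 1 / real k - (real H)\<^sup>2 / (real k + 1)) * T"
      by (simp add: algebra_simps)
    also have "\<dots> \<le> (real H + 2) / real k * T"
    proof (intro mult_right_mono)
      have "(real H)\<^sup>2 \<le> real k + 1"
        using of_nat_mono[OF k(3), where 'a = real] unfolding of_nat_power by linarith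
      then have "(real H)\<^sup>2 / (real k + 1) / real k \<le> 1 / real k"
        by (intro divide_right_mono) auto
      moreover have "(real H)\<^sup>2 / (real k + 1) / real k = (real H)\<^sup>2 / real k - (real H)\<^sup>2 / (real k + 1)"
        using k(1) by (simp add: divide_simps) (simp add: algebra_simps)
      ultimately show "real H * (real H + 1) / real k + 1 / real k - (real H)\<^sup>2 / (real k + 1) \<le> (real H + 2) / real k"
        by (simp add: add_divide_distrib distrib_left power2_eq_square)
    qed (use T in simp)
    finally show ?case unfolding T_def y_def .
  qed
qed

lemma sum_window_corr_bounds:
  fixes D N H :: nat
  assumes "M > 0"
  defines "A \<equiv> (real H * real N)\<^sup>2 / of_int M"
  assumes V: "window_corr {1..N} y M H 0 - A \<le> V"
  shows "(\<Sum>u\<in>{- int D..int D}. window_corr {1..N} y M H u) \<le> (2 * real D + 1) * (A + V)"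
    and "(2 * real D + 1) * (A - V) \<le> (\<Sum>u\<in>{- int D..int D}. window_corr {1..N} y M H u)"
proof -
  have dev: "\<bar>window_corr {1..N} y M H u - A\<bar> \<le> V" for u
    using window_corr_deviation[OF assms(1), of "{1..N}" y H u] V unfolding A_def by simp
  have card: "real (card {- int D..int D}) = 2 * real D + 1" by simp
  have "window_corr {1..N} y M H u \<le> A + V" "A - V \<le> window_corr {1..N} y M H u" for u
    using dev[of u] by linarith+
  then show "(\<Sum>u\<in>{- int D..int D}. window_corr {1..N} y M H u) \<le> (2 * real D + 1) * (A + V)"
    and "(2 * real D + 1) * (A - V) \<le> (\<Sum>u\<in>{- int D..int D}. window_corr {1..N} y M H u)"
    using sum_bounded_above[of "{- int D..int D}" "window_corr {1..N} y M H" "A + V"]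
      sum_bounded_below[of "{- int D..int D}" "A - V" "window_corr {1..N} y M H"]
    unfolding card by auto
qed

text \<open>H is fixed first, so that 6 s / H < \<epsilon>. As k grows, the two products tend to 2 s
  (1 + 3 / H) and 2 s (1 - 3 / H). In each product the first factor bounds the number of lags, and
  the second bounds mean plus or minus variance, divided by H^2 and the normalisation.\<close>

lemma exists_window_parameters:
  fixes s s\<^sub>0 \<epsilon> :: real
  assumes "s > 0" "s\<^sub>0 > 0" "\<epsilon> > 0"
  obtains H k :: nat where "H \<ge> 6" "k \<ge> 1" "2 * H \<le> k" "H\<^sup>2 \<le> k" "real H / real k < s\<^sub>0"
    "real H + 2 \<le> s * real k"
    "(2 * s * (real k + 1) + 2 * real H + 3) * (1 / real k + 3 / (real k * real H)) < 2 * s + \<epsilon>"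
    "(2 * s * real k - 2 * real H - 3) * (1 / (real k + 1) - 3 / (real k * real H)) > 2 * s - \<epsilon>"
proof -
  define H where "H = nat \<lceil>6 * s / \<epsilon>\<rceil> + 6"
  have H: "H \<ge> 6" unfolding H_def by simp
  have "6 * s / \<epsilon> < real H" unfolding H_def by linarith
  then have \<epsilon>: "6 * s / real H < \<epsilon>" using assms H by (simp add: field_simps)
  have "(\<lambda>k. (2 * s * (real k + 1) + 2 * real H + 3) * (1 / real k + 3 / (real k * real H)))
        \<longlonglongrightarrow> 2 * s * (1 + 3 / real H)"
    using H assms(1) by (real_asymp simp: field_simps)
  moreover have "2 * s * (1 + 3 / real H) < 2 * s + \<epsilon>" using \<epsilon> by (simp add: algebra_simps)
  ultimately have up: "\<forall>\<^sub>F k in sequentially.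
     (2 * s * (real k + 1) + 2 * real H + 3) * (1 / real k + 3 / (real k * real H)) < 2 * s + \<epsilon>"
    by (rule order_tendstoD(2))
  have "(\<lambda>k. (2 * s * real k - 2 * real H - 3) * (1 / (real k + 1) - 3 / (real k * real H)))
        \<longlonglongrightarrow> 2 * s * (1 - 3 / real H)"
    using H assms(1) by (real_asymp simp: field_simps)
  moreover have "2 * s - \<epsilon> < 2 * s * (1 - 3 / real H)" using \<epsilon> by (simp add: algebra_simps)
  ultimately have lo: "\<forall>\<^sub>F k in sequentially.
     2 * s - \<epsilon> < (2 * s * real k - 2 * real H - 3) * (1 / (real k + 1) - 3 / (real k * real H))"
    by (rule order_tendstoD(1))
  have s0: "\<forall>\<^sub>F k in sequentially. real H / real k < s\<^sub>0"
    using lim_const_over_n[of "real H"] assms(2) by (rule order_tendstoD(2))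
  have "\<forall>\<^sub>F k in sequentially. real k \<ge> (real H + 2) / s"
    using filterlim_real_sequentially by (simp add: filterlim_at_top)
  then have sk: "\<forall>\<^sub>F k in sequentially. real H + 2 \<le> s * real k"
    by eventually_elim (use assms(1) in \<open>simp add: field_simps\<close>)
  have "\<exists>k. real H / real k < s\<^sub>0 \<and> real H + 2 \<le> s * real k \<and> 1 \<le> k \<and> 2 * H \<le> k \<and> H\<^sup>2 \<le> k \<and>
    (2 * s * (real k + 1) + 2 * real H + 3) * (1 / real k + 3 / (real k * real H)) < 2 * s + \<epsilon> \<and>
    2 * s - \<epsilon> < (2 * s * real k - 2 * real H - 3) * (1 / (real k + 1) - 3 / (real k * real H))"
    by (rule eventually_happens'[of sequentially])
      (intro eventually_conj up lo s0 sk eventually_ge_at_top sequentially_bot)+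
  then show ?thesis using that H by blast
qed

section \<open>The limit at an arbitrary scale\<close>

text \<open>The hypothesis \<open>half\<close> keeps the radius s / N^\<beta> at most 1/2, so that
  the range of differences in the lower bound does not wrap around the circle.\<close>

lemma pair_corr_tendsto_of_small_scales:
  fixes x :: "nat \<Rightarrow> real" and \<beta> s s\<^sub>0 :: real
  assumes \<beta>: "0 \<le> \<beta>" "\<beta> < 1" and s0: "s\<^sub>0 > 0" and s: "s > 0"
    and lim: "\<And>s. 0 < s \<Longrightarrow> s < s\<^sub>0 \<Longrightarrow> (\<lambda>N. pair_corr x \<beta> s N) \<longlonglongrightarrow> 2 * s"
    and half: "\<forall>\<^sub>F N in sequentially. 2 * s \<le> real N powr \<beta>"
  shows "(\<lambda>N. pair_corr x \<beta> s N) \<longlonglongrightarrow> 2 * s"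
proof -
  have "(\<lambda>N. close_pairs x N (s / real N powr \<beta>) / real N powr (2 - \<beta>)) \<longlonglongrightarrow> 2 * s"
  proof (rule tendstoI)
    fix \<epsilon> :: real assume "\<epsilon> > 0"
    obtain H k :: nat where H: "H \<ge> 6" and k: "k \<ge> 1" "2 * H \<le> k" "H\<^sup>2 \<le> k" "real H / real k < s\<^sub>0"
      and sk: "real H + 2 \<le> s * real k"
      and up: "(2 * s * (real k + 1) + 2 * real H + 3) * (1 / real k + 3 / (real k * real H)) < 2 * s + \<epsilon>"
      and lo: "(2 * s * real k - 2 * real H - 3) * (1 / (real k + 1) - 3 / (real k * real H)) > 2 * s - \<epsilon>"
      using exists_window_parameters[OF s s0 \<open>\<epsilon> > 0\<close>] by metis
    define M where "M N = \<lceil>real k * real N powr \<beta>\<rceil>" for N :: nat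
    have "\<forall>\<^sub>F N in sequentially.
       window_corr {1..N} (\<lambda>n. \<lfloor>of_int (M N) * x n\<rfloor>) (M N) H 0 - (real H * real N)\<^sup>2 / of_int (M N)
       \<le> (real H + 2) / real k * real N powr (2 - \<beta>)"
      unfolding M_def by (rule eventually_window_variance_le[OF \<beta> lim k])
    then show "\<forall>\<^sub>F N in sequentially.
      dist (close_pairs x N (s / real N powr \<beta>) / real N powr (2 - \<beta>)) (2 * s) < \<epsilon>"
      using half eventually_ge_at_top[of 1]
    proof eventually_elim
      case (elim N)
      define y where "y = (\<lambda>n. \<lfloor>of_int (M N) * x n\<rfloor>)"
      define T where "T = real N powr (2 - \<beta>)"
      define L where "L = real N powr \<beta>"
      define A where "A = (real H * real N)\<^sup>2 / of_int (M N)"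
      \<comment> \<open>H + 2 is rounded up to 3 H. Compared with \<open>A\<close>, about H^2 / k
        times \<open>T\<close>, this is a relative error of about 3 / H.\<close>
      define V where "V = 3 * real H / real k * T"
      define C where "C = close_pairs x N (s / L)"
      define Q where "Q = (\<lambda>h. \<Sum>d\<in>{- int h..int h}. diff_count {1..N} y (M N) d)"
      note b = window_mean_bounds[OF \<beta>(1) elim(3) k(1), folded M_def, folded T_def L_def]
      have T: "T > 0" unfolding T_def using elim by simp
      have L: "L \<ge> 1" unfolding L_def using elim \<beta> by (simp add: ge_one_powr_ge_zero)
      have kL: "real k * L > 0" using L k(1) by simp
      then have M: "M N > 0" using b(1) by linarith
      have "(real H + 2) / real k * T \<le> V"
        unfolding V_def using T H by (intro mult_right_mono divide_right_mono) auto
      then have V: "window_corr {1..N} y (M N) H 0 - A \<le> V"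
        using elim(1) unfolding y_def A_def T_def by linarith
      note W = sum_window_corr_bounds[OF M V[unfolded A_def], folded A_def]
      have H2: "(real H)\<^sup>2 > 0" using H by simp

      \<comment> \<open>Upper bound: since M is at most (k + 1) L, this h satisfies s / L \<le> h /
        M.\<close>
      define h where "h = nat \<lceil>s * (real k + 1)\<rceil>"
      have h: "s * (real k + 1) \<le> real h" "real h \<le> s * (real k + 1) + 1"
        unfolding h_def using s by (auto simp: of_nat_nat)
      have "s * of_int (M N) \<le> s * ((real k + 1) * L)"
        using b(2) s by (intro mult_left_mono) auto
      also have "\<dots> \<le> real h * L"
        using mult_right_mono[OF h(1), of L] L by (simp add: mult.assoc)
      finally have "C \<le> Q h"
        unfolding C_def Q_def y_def using M L
        by (intro close_pairs_le_sum_diff_count) (auto simp: field_simps)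
      then have "(real H)\<^sup>2 * C \<le> (real H)\<^sup>2 * Q h" by (simp add: mult_left_mono)
      also have "\<dots> \<le> (2 * real (h + H) + 1) * (A + V)"
        unfolding Q_def by (rule order_trans[OF sum_diff_count_le_window_corr W(1)])
      also have "\<dots> \<le> (2 * s * (real k + 1) + 2 * real H + 3) * ((real H)\<^sup>2 / real k * T + V)"
      proof (rule mult_mono)
        show "2 * real (h + H) + 1 \<le> 2 * s * (real k + 1) + 2 * real H + 3"
          using h(2) by (simp add: mult.assoc)
        show "A + V \<le> (real H)\<^sup>2 / real k * T + V"
          using b(3)[of H] unfolding A_def by simp
        show "0 \<le> A + V"
          unfolding A_def V_def using M T by (intro add_nonneg_nonneg) auto
      qed (use s in auto)
      also have "\<dots> = (real H)\<^sup>2 *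
          ((2 * s * (real k + 1) + 2 * real H + 3) * (1 / real k + 3 / (real k * real H)) * T)"
        unfolding V_def using H k(1) by (simp add: field_simps power2_eq_square)
      finally have "C \<le> (2 * s * (real k + 1) + 2 * real H + 3) * (1 / real k + 3 / (real k * real H)) * T"
        using H2 by simp
      also have "\<dots> < (2 * s + \<epsilon>) * T" using up T by simp
      finally have upper: "C / T < 2 * s + \<epsilon>" using T by (simp add: field_simps)

      \<comment> \<open>Lower bound: H is given up because lags up to D involve differences up to D
        + H, and 1 because of the floors. By \<open>sk\<close> the natural subtraction does not
        truncate.\<close>
      define D where "D = nat \<lfloor>s * real k\<rfloor> - 1 - H"
      have D: "real (D + H) + 1 \<le> s * real k" "2 * s * real k - 2 * real H - 3 \<le> 2 * real D + 1"
        unfolding D_def using sk by linarith+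
      have "2 * real (D + H) + 1 \<le> 2 * s * real k" using D(1) by simp
      also have "\<dots> \<le> real k * L"
        using mult_right_mono[OF elim(2), of "real k"] unfolding L_def by (simp add: mult.commute)
      also have "\<dots> \<le> of_int (M N)" by (rule b(1))
      finally have DM: "2 * int (D + H) + 1 \<le> M N" by linarith
      have "real (D + H + 1) * L \<le> s * real k * L"
        using D(1) L by (intro mult_right_mono) auto
      also have "\<dots> \<le> s * of_int (M N)"
        using b(1) s by (simp add: mult.assoc)
      finally have "Q (D + H) \<le> C"
        unfolding C_def Q_def y_def using M L DM
        by (intro sum_diff_count_le_close_pairs) (auto simp: field_simps)
      \<comment> \<open>The sign is needed to multiply \<open>D(2)\<close> by this factor; it rests
        on H \<ge> 6.\<close>
      have "1 / (real k + 1) - 3 / (real k * real H) \<ge> 0"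
      proof -
        have "3 * (real k + 1) \<le> 6 * real k" using k(1) by simp
        also have "\<dots> \<le> real k * real H" using H by (subst mult.commute) (simp add: mult_left_mono)
        finally show ?thesis using k(1) H by (simp add: field_simps)
      qed
      then have "(2 * s * real k - 2 * real H - 3) * (1 / (real k + 1) - 3 / (real k * real H))
        \<le> (2 * real D + 1) * (1 / (real k + 1) - 3 / (real k * real H))"
        using D(2) by (intro mult_right_mono)
      then have "(2 * s - \<epsilon>) < (2 * real D + 1) * (1 / (real k + 1) - 3 / (real k * real H))"
        using lo by linarith
      then have "(2 * s - \<epsilon>) * T < (2 * real D + 1) * (1 / (real k + 1) - 3 / (real k * real H)) * T"
        using T by simp
      then have "(real H)\<^sup>2 * ((2 * s - \<epsilon>) * T) <
          (real H)\<^sup>2 * ((2 * real D + 1) * (1 / (real k + 1) - 3 / (real k * real H)) * T)"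
        using H2 by (rule mult_strict_left_mono)
      also have "\<dots> = (2 * real D + 1) * ((real H)\<^sup>2 / (real k + 1) * T - V)"
        unfolding V_def using H k(1) by (simp add: divide_simps power2_eq_square) (simp add: algebra_simps)
      also have "\<dots> \<le> (2 * real D + 1) * (A - V)"
        using b(4)[of H] unfolding A_def by (intro mult_left_mono diff_right_mono) auto
      also have "\<dots> \<le> (real H)\<^sup>2 * Q (D + H)"
        unfolding Q_def by (rule order_trans[OF W(2) window_corr_le_sum_diff_count])
      also have "\<dots> \<le> (real H)\<^sup>2 * C"
        using \<open>Q (D + H) \<le> C\<close> by (simp add: mult_left_mono)
      finally have "(2 * s - \<epsilon>) * T < C" using H2 by simp
      then have "2 * s - \<epsilon> < C / T" using T by (simp add: field_simps)
      with upper show ?case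
        unfolding C_def L_def T_def by (simp add: dist_real_def abs_less_iff)
    qed
  qed
  \<comment> \<open>The diagonal pairs are now removed again.\<close>
  moreover have "(\<lambda>N. real N powr (\<beta> - 1)) \<longlonglongrightarrow> 0"
    using \<beta>(2) by (intro tendsto_neg_powr filterlim_real_sequentially) auto
  ultimately have "(\<lambda>N. close_pairs x N (s / real N powr \<beta>) / real N powr (2 - \<beta>)
      - real N powr (\<beta> - 1)) \<longlonglongrightarrow> 2 * s - 0"
    by (rule tendsto_diff)
  moreover have "\<forall>\<^sub>F N in sequentially. close_pairs x N (s / real N powr \<beta>) / real N powr (2 - \<beta>)
      - real N powr (\<beta> - 1) = pair_corr x \<beta> s N"
    using eventually_ge_at_top[of 1]
    by eventually_elim (use s in \<open>simp add: close_pairs_eq_pair_corr\<close>)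
  ultimately show ?thesis
    by (simp add: tendsto_cong)
qed

theorem theorem2:
  fixes \<beta> :: real and x :: "nat \<Rightarrow> real"
  assumes "0 \<le> \<beta>" and "\<beta> < 1"
    and "\<And>n. n \<ge> 1 \<Longrightarrow> x n \<in> {0..1}"
    and "\<exists>s\<^sub>0>0. \<forall>s. 0 < s \<and> s < s\<^sub>0 \<longrightarrow> (\<lambda>N. pair_corr x \<beta> s N) \<longlonglongrightarrow> 2 * s"
  shows "has_PPC \<beta> x"
proof -
  obtain s\<^sub>0 where s0: "s\<^sub>0 > 0"
    and lim: "\<And>s. 0 < s \<Longrightarrow> s < s\<^sub>0 \<Longrightarrow> (\<lambda>N. pair_corr x \<beta> s N) \<longlonglongrightarrow> 2 * s"
    using assms(4) by blast
  note main = pair_corr_tendsto_of_small_scales[OF assms(1,2) s0 _ lim]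
  show ?thesis
  proof (cases "\<beta> = 0")
    case True
    have "(\<lambda>N. pair_corr x 0 s N) \<longlonglongrightarrow> 2 * s" if "0 < s" "s \<le> 1 / 2" for s
    proof -
      \<comment> \<open>For N \<ge> 1 the power is 1, so the no-wrapping condition is just s \<le>
        1/2, the range in the definition of 0-PPC.\<close>
      have "\<forall>\<^sub>F N in sequentially. 2 * s \<le> real N powr \<beta>"
        using eventually_ge_at_top[of 1] by eventually_elim (use that True in simp)
      then show ?thesis using main[of s] that True by simp
    qed
    with True show ?thesis unfolding has_PPC_def by blast
  next
    case False
    with assms(1) have pos: "\<beta> > 0" by simp
    have "(\<lambda>N. pair_corr x \<beta> s N) \<longlonglongrightarrow> 2 * s" if "s > 0" for s
    proof -
      have "filterlim (\<lambda>N. real N powr \<beta>) at_top sequentially"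
        using pos by real_asymp
      then have "\<forall>\<^sub>F N in sequentially. 2 * s \<le> real N powr \<beta>"
        by (simp add: filterlim_at_top)
      then show ?thesis using main[of s] that by simp
    qed
    with pos assms(2) show ?thesis unfolding has_PPC_def by simp
  qed
qed

end
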